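(* Let $\mathcal{C}\subseteq\mathbb{N}^p$ be an affine integer cone and let $\preceq$ be a total order on $\mathbb{N}^p$ such that $\mathcal{N}(x)$ is finite for every $x\in\mathcal{C}$. For any $f\in\mathcal{C}\setminus\{0\}$ and any positive integer $g$, the set $\mathfrak{C}(Fb=f,\,gen=g)$ of all $\mathcal{C}$-semigroups with Frobenius element $f$ and genus $g$ is non-empty if and only if $$\left\lceil \frac{\sharp\mathcal{B}(f)}{2}\right\rceil\leq g\leq \mathcal{N}(f).$$
   Context: $\mathbb{N}$ contains $0$. An affine integer cone $\mathcal{C}\subseteq\mathbb{N}^p$ is a set $L(A)\cap\mathbb{N}^p$ with $A\subseteq\mathcal{C}$ finite and non-empty, where $L(A)$ is the set of non-negative real linear combinations of elements of $A$. A $\mathcal{C}$-semigroup is a submonoid $S\subseteq\mathcal{C}$ (containing $0$) such that $\mathcal{C}\setminus S$ is finite; its genus is $\mathrm{g}(S)=\sharp(\mathcal{C}\setminus S)$, where $\sharp$ denotes cardinality. A total order on $\mathbb{N}^p$ means a total order relation $\preceq$ compatible with addition and satisfying $0\preceq x$ for all $x\in\mathbb{N}^p$. For $S\neq\mathcal{C}$, the Frobenius element is $\mathrm{Fb}(S)=\max_\preceq(\mathcal{C}\setminus S)$; by convention $\mathrm{Fb}(\mathcal{C})=(-1,\ldots,-1)$. For $f\in\mathcal{C}$, $\mathcal{N}(f)=\sharp\{x\in\mathcal{C}\setminus\{0\}\mid x\preceq f\}$. Write $x\leq_{\mathcal{C}}y$ if $y-x\in\mathcal{C}$, and $\mathcal{B}(f)=\{x\in\mathcal{C}\mid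 x\leq_{\mathcal{C}}f\}$. *)

theory Defs
  imports "HOL-Analysis.Finite_Cartesian_Product"
begin

definition real_vec :: "nat ^ 'p \<Rightarrow> real ^ 'p" where
  "real_vec x = (\<chi> i. real (x $ i))"

definition int_vec :: "nat ^ 'p \<Rightarrow> int ^ 'p" where
  "int_vec x = (\<chi> i. int (x $ i))"

text \<open>Only used for finite \<open>A\<close>.\<close>

definition nonneg_span :: "(nat ^ 'p) set \<Rightarrow> (real ^ 'p) set" where
  "nonneg_span A = {(\<Sum>a\<in>A. c a *\<^sub>R real_vec a) | c. \<forall>a\<in>A. (0::real) \<le> c a}"

definition affine_integer_cone :: "(nat ^ 'p) set \<Rightarrow> bool" where
  "affine_integer_cone C \<longleftrightarrow>
     (\<exists>A. finite A \<and> A \<noteq> {} \<and> A \<subseteq> C \<and> C = {x. real_vec x \<in> nonneg_span A})"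

definition monoid_total_order :: "(nat ^ 'p \<Rightarrow> nat ^ 'p \<Rightarrow> bool) \<Rightarrow> bool" where
  "monoid_total_order le \<longleftrightarrow>
     linear_order {(x, y). le x y} \<and>
     (\<forall>x y z. le x y \<longrightarrow> le (x + z) (y + z)) \<and>
     (\<forall>x. le 0 x)"

definition C_semigroup :: "(nat ^ 'p) set \<Rightarrow> (nat ^ 'p) set \<Rightarrow> bool" where
  "C_semigroup C S \<longleftrightarrow>
     S \<subseteq> C \<and> 0 \<in> S \<and> (\<forall>x\<in>S. \<forall>y\<in>S. x + y \<in> S) \<and> finite (C - S)"

definition genus :: "(nat ^ 'p) set \<Rightarrow> (nat ^ 'p) set \<Rightarrow> nat" where
  "genus C S = card (C - S)"

text \<open>The value lies in \<open>int ^ 'p\<close> because of the convention for \<open>S = C\<close>.\<close>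

definition Fb :: "(nat ^ 'p \<Rightarrow> nat ^ 'p \<Rightarrow> bool) \<Rightarrow> (nat ^ 'p) set \<Rightarrow> (nat ^ 'p) set \<Rightarrow> int ^ 'p" where
  "Fb le C S =
     (if S = C then (\<chi> i. - 1)
      else int_vec (THE m. m \<in> C - S \<and> (\<forall>x\<in>C - S. le x m)))"

definition lower_set :: "(nat ^ 'p \<Rightarrow> nat ^ 'p \<Rightarrow> bool) \<Rightarrow> (nat ^ 'p) set \<Rightarrow> nat ^ 'p \<Rightarrow> (nat ^ 'p) set" where
  "lower_set le C f = {x \<in> C - {0}. le x f}"

text \<open>Subtraction on \<open>nat ^ 'p\<close> truncates, so \<open>y - x \<in> C\<close> is expressed through addition.\<close>

definition cone_le :: "(nat ^ 'p) set \<Rightarrow> nat ^ 'p \<Rightarrow> nat ^ 'p \<Rightarrow> bool" where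
  "cone_le C x y \<longleftrightarrow> (\<exists>z\<in>C. y = x + z)"

definition cone_below :: "(nat ^ 'p) set \<Rightarrow> nat ^ 'p \<Rightarrow> (nat ^ 'p) set" where
  "cone_below C f = {x \<in> C. cone_le C x f}"

definition semigroups_Fb_genus ::
  "(nat ^ 'p \<Rightarrow> nat ^ 'p \<Rightarrow> bool) \<Rightarrow> (nat ^ 'p) set \<Rightarrow> nat ^ 'p \<Rightarrow> nat \<Rightarrow> (nat ^ 'p) set set" where
  "semigroups_Fb_genus le C f g =
     {S. C_semigroup C S \<and> Fb le C S = int_vec f \<and> genus C S = g}"

end

theory Submission
  imports Defs
begin

text \<open>
  If \<open>f \<notin> S\<close>, then of any two elements of the cone with sum \<open>f\<close> at least one is a gap, so at
  least half of \<open>\<B>(f)\<close> consists of gaps; and all gaps are non-zero and \<open>\<preceq> f\<close>.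
  Conversely, let \<open>S\<^sub>0\<close> consist of \<open>0\<close> and all \<open>x \<in> C - {f}\<close> with \<open>x \<notin> \<B>(f)\<close> or \<open>f \<prec> 2x\<close>.
  As the complement of \<open>\<B>(f)\<close> is an ideal of \<open>C\<close> and all elements of \<open>\<B>(f)\<close> are \<open>\<preceq> f\<close>, this is
  a semigroup. It has as many gaps as there are \<open>x \<in> \<B>(f)\<close> with \<open>2x \<preceq> f\<close>, which is
  \<open>\<lceil>\<sharp>\<B>(f) / 2\<rceil>\<close> because \<open>x \<mapsto> f - x\<close> exchanges \<open>2x \<prec> f\<close> and \<open>f \<prec> 2x\<close>.
  Removing the least non-zero element, as long as it is \<open>\<preceq> f\<close>, raises the genus by one and
  keeps the Frobenius element.
\<close>

section \<open>Additive structure of real cones and coordinate embeddings\<close>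

lemma nonneg_span_zero: "0 \<in> nonneg_span A"
  unfolding nonneg_span_def by (auto intro!: exI[of _ "\<lambda>_. 0"])

lemma nonneg_span_add:
  assumes "u \<in> nonneg_span A" "v \<in> nonneg_span A"
  shows "u + v \<in> nonneg_span A"
proof -
  obtain c d where "u = (\<Sum>a\<in>A. c a *\<^sub>R real_vec a)" "v = (\<Sum>a\<in>A. d a *\<^sub>R real_vec a)"
    and "\<forall>a\<in>A. 0 \<le> c a" "\<forall>a\<in>A. 0 \<le> d a"
    using assms unfolding nonneg_span_def by blast
  then show ?thesis
    unfolding nonneg_span_def
    by (auto intro!: exI[of _ "\<lambda>a. c a + d a"] simp: scaleR_add_left sum.distrib)
qed

lemma real_vec_zero: "real_vec 0 = 0"
  by (simp add: real_vec_def vec_eq_iff)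

lemma real_vec_add: "real_vec (x + y) = real_vec x + real_vec y"
  by (simp add: real_vec_def vec_eq_iff)

lemma int_vec_inject: "int_vec x = int_vec y \<longleftrightarrow> x = y"
  by (simp add: int_vec_def vec_eq_iff)

lemma int_vec_neq_minus_one: "int_vec x \<noteq> (\<chi> i. - 1)"
  by (simp add: int_vec_def vec_eq_iff)

section \<open>The cone as a monoid with a compatible total order\<close>

locale ordered_cone =
  fixes C :: "(nat ^ 'p) set" and le :: "nat ^ 'p \<Rightarrow> nat ^ 'p \<Rightarrow> bool"
  assumes cone_zero: "0 \<in> C"
    and cone_add: "x \<in> C \<Longrightarrow> y \<in> C \<Longrightarrow> x + y \<in> C"
    and le_refl: "le x x"
    and le_antisym: "le x y \<Longrightarrow> le y x \<Longrightarrow> x = y"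
    and le_trans: "le x y \<Longrightarrow> le y z \<Longrightarrow> le x z"
    and le_total: "le x y \<or> le y x"
    and le_add_right: "le x y \<Longrightarrow> le (x + z) (y + z)"
    and zero_le: "le 0 x"

lemma ordered_coneI:
  assumes "affine_integer_cone C" "monoid_total_order le"
  shows "ordered_cone C le"
proof
  obtain A where C: "C = {x. real_vec x \<in> nonneg_span A}"
    using assms(1) unfolding affine_integer_cone_def by blast
  show "0 \<in> C"
    by (simp add: C real_vec_zero nonneg_span_zero)
  show "x + y \<in> C" if "x \<in> C" "y \<in> C" for x y
    using that by (simp add: C real_vec_add nonneg_span_add)
  have lin: "linear_order {(x, y). le x y}"
    using assms(2) unfolding monoid_total_order_def by blast
  show refl: "le x x" for x
    using lin by (auto simp: order_on_defs refl_on_def)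
  show "x = y" if "le x y" "le y x" for x y
    using lin that by (auto simp: order_on_defs antisym_def)
  show "le x z" if "le x y" "le y z" for x y z
    using lin that unfolding order_on_defs trans_def by blast
  \<comment> \<open>\<open>total_on\<close> compares distinct elements only, so reflexivity has to
    settle \<open>x = y\<close>.\<close>
  show "le x y \<or> le y x" for x y
    using lin refl by (cases "x = y") (auto simp: order_on_defs total_on_def)
  show "le (x + z) (y + z)" if "le x y" for x y z
    using assms(2) that unfolding monoid_total_order_def by blast
  show "le 0 x" for x
    using assms(2) unfolding monoid_total_order_def by blast
qed

context ordered_cone
begin

lemma le_add_mono: "le x y \<Longrightarrow> le u v \<Longrightarrow> le (x + u) (y + v)"
  using le_add_right[of x y u] le_add_right[of u v y] le_trans by (simp add: add.commute)

lemma le_add_self: "le x (x + y)"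
  using le_add_mono[OF le_refl zero_le, of x y] by simp

text \<open>Shows that \<open>f\<close> has at most one half in the monoid.\<close>

lemma double_inject:
  assumes "x + x = y + y"
  shows "x = (y :: nat ^ 'p)"
  using assms by (simp add: vec_eq_iff flip: mult_2)

lemma finite_has_greatest:
  assumes "finite A" "A \<noteq> {}"
  obtains m where "m \<in> A" "\<And>x. x \<in> A \<Longrightarrow> le x m"
proof -
  have "transp_on A le" "totalp_on A le"
    using le_trans le_total unfolding transp_on_def totalp_on_def by blast+
  then show ?thesis
    using Finite_Set.bex_greatest_element[of A le] assms that le_refl by metis
qed

lemma finite_has_least:
  assumes "finite A" "A \<noteq> {}"
  obtains m where "m \<in> A" "\<And>x. x \<in> A \<Longrightarrow> le m x"
proof -
  have "transp_on A le" "totalp_on A le"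
    using le_trans le_total unfolding transp_on_def totalp_on_def by blast+
  then show ?thesis
    using Finite_Set.bex_least_element[of A le] assms that le_refl by metis
qed

text \<open>The convention for \<open>S = C\<close> cannot interfere, since no
  \<open>int_vec f\<close> has negative entries. Otherwise the finite, non-empty set of gaps has
  exactly one maximum, so \<open>THE\<close> is well defined.\<close>

lemma Fb_eq_iff:
  assumes "S \<subseteq> C" "finite (C - S)"
  shows "Fb le C S = int_vec f \<longleftrightarrow> f \<in> C - S \<and> (\<forall>x\<in>C - S. le x f)"
proof (cases "S = C")
  case True
  then show ?thesis
    using int_vec_neq_minus_one[of f] by (auto simp: Fb_def)
next
  case False
  with assms obtain m where m: "m \<in> C - S" "\<And>x. x \<in> C - S \<Longrightarrow> le x m"
    using finite_has_greatest[of "C - S"] by blast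
  have unique: "m' = m" if "m' \<in> C - S \<and> (\<forall>x\<in>C - S. le x m')" for m'
    using that m le_antisym by blast
  have "(THE m. m \<in> C - S \<and> (\<forall>x\<in>C - S. le x m)) = m"
    by (rule the_equality) (use m unique in blast)+
  with False have "Fb le C S = int_vec m"
    by (simp add: Fb_def)
  then show ?thesis
    using m unique int_vec_inject by metis
qed

lemma semigroups_Fb_genus_iff:
  "S \<in> semigroups_Fb_genus le C f g \<longleftrightarrow>
     C_semigroup C S \<and> f \<in> C - S \<and> (\<forall>x\<in>C - S. le x f) \<and> card (C - S) = g"
  using Fb_eq_iff[of S f] by (auto simp: semigroups_Fb_genus_def genus_def C_semigroup_def)

lemma gaps_subset_lower_set:
  assumes "S \<in> semigroups_Fb_genus le C f g"
  shows "C - S \<subseteq> lower_set le C f"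
  using assms by (auto simp: semigroups_Fb_genus_iff lower_set_def C_semigroup_def)

section \<open>The set \<open>cone_below C f\<close> and its reflection by
  \<open>f - x\<close>\<close>

lemma cone_below_iff: "x \<in> cone_below C f \<longleftrightarrow> x \<in> C \<and> f - x \<in> C \<and> f = x + (f - x)"
  unfolding cone_below_def cone_le_def by (auto simp: add_diff_cancel_left')

lemma cone_below_diff:
  assumes "x \<in> cone_below C f"
  shows "f - x \<in> cone_below C f"
proof -
  have "f - (f - x) = x"
    using assms by (metis add_diff_cancel_right' cone_below_iff)
  then show ?thesis
    using assms by (simp add: cone_below_iff add.commute)
qed

lemma inj_on_diff_cone_below: "inj_on (\<lambda>x. f - x) (cone_below C f)"
  by (rule inj_onI) (metis add_right_imp_eq cone_below_iff)

lemma cone_below_le: "x \<in> cone_below C f \<Longrightarrow> le x f"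
  by (metis cone_below_iff le_add_self)

text \<open>In contrapositive form: the complement of \<open>cone_below C f\<close> is an ideal of
  \<open>C\<close>.\<close>

lemma cone_below_addD:
  assumes "x \<in> C" "y \<in> C" "x + y \<in> cone_below C f"
  shows "x \<in> cone_below C f"
  using assms cone_add unfolding cone_below_def cone_le_def by (auto simp: add.assoc)

lemma finite_cone_below:
  assumes "finite (lower_set le C f)"
  shows "finite (cone_below C f)"
proof (rule finite_subset)
  show "cone_below C f \<subseteq> insert 0 (lower_set le C f)"
    using cone_below_le by (auto simp: lower_set_def cone_below_def)
qed (use assms in simp)

section \<open>The lower bound on the genus\<close>

lemma card_cone_below_le_double_genus:
  assumes "S \<in> semigroups_Fb_genus le C f g"
  shows "card (cone_below C f) \<le> 2 * g"
proof -
  let ?G = "C - S"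
  have S: "finite ?G" "f \<in> ?G" "\<And>x y. x \<in> S \<Longrightarrow> y \<in> S \<Longrightarrow> x + y \<in> S" "card ?G = g"
    using assms by (auto simp: semigroups_Fb_genus_iff C_semigroup_def)
  \<comment> \<open>The gaps and their reflections, at most \<open>g\<close> of each, cover
    \<open>cone_below C f\<close>.\<close>
  have "x \<in> ?G \<union> (\<lambda>x. f - x) ` ?G" if "x \<in> cone_below C f" for x
  proof (cases "x \<in> S")
    case True
    have x: "f - x \<in> C" "f = x + (f - x)"
      using that by (simp_all add: cone_below_iff)
    have "f - x \<notin> S"
      using S(2) S(3)[OF True] x(2) by (metis DiffD2)
    moreover have "x = f - (f - x)"
      using x(2) by (metis add_diff_cancel_right')
    ultimately show ?thesis
      using x(1) by blast
  next
    case False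
    then show ?thesis
      using that by (simp add: cone_below_def)
  qed
  then have "card (cone_below C f) \<le> card (?G \<union> (\<lambda>x. f - x) ` ?G)"
    using S(1) by (intro card_mono) auto
  also have "\<dots> \<le> card ?G + card ((\<lambda>x. f - x) ` ?G)"
    by (rule card_Un_le)
  also have "\<dots> \<le> 2 * g"
    using card_image_le[OF S(1), of "\<lambda>x. f - x"] S(4) by simp
  finally show ?thesis .
qed

section \<open>A semigroup of small genus\<close>

lemma double_card_lower_half:
  assumes "finite (cone_below C f)"
  shows "2 * card {x \<in> cone_below C f. le (x + x) f} \<le> card (cone_below C f) + 1"
proof -
  let ?B = "cone_below C f"
  let ?L = "{x \<in> ?B. le (x + x) f}"
  let ?U = "(\<lambda>x. f - x) ` ?L"
  have U: "le f (y + y)" if y: "y \<in> ?U" for y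
  proof -
    obtain x where x: "x \<in> ?B" "le (x + x) f" "y = f - x"
      using y by blast
    then have eq: "f = x + y"
      by (simp add: cone_below_iff)
    \<comment> \<open>Cancels \<open>x\<close> from \<open>x + x \<le> x + y\<close>: compatibility
      only adds summands, so totality and antisymmetry are needed to cancel one.\<close>
    have "le x y"
    proof (rule ccontr)
      assume "\<not> le x y"
      then have "le (y + x) (x + x)" "x \<noteq> y"
        using le_total[of x y] le_add_right[of y x x] le_refl by auto
      moreover have "le (x + x) (y + x)"
        using x(2) eq by (simp add: add.commute)
      ultimately show False
        using le_antisym by fastforce
    qed
    then show ?thesis
      using eq le_add_right by simp
  qed
  \<comment> \<open>A common element is a half of \<open>f\<close>; this possible overlap accounts
    for the \<open>+ 1\<close> in the bound.\<close>
  have "y = z" if "y \<in> ?L \<inter> ?U" "z \<in> ?L \<inter> ?U" for y z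
  proof -
    have "y + y = f" "z + z = f"
      using that U le_antisym by blast+
    then show ?thesis
      using double_inject by metis
  qed
  then have inter: "card (?L \<inter> ?U) \<le> 1"
    using card_le_Suc0_iff_eq[of "?L \<inter> ?U"] assms by auto
  have "card ?U = card ?L"
    by (rule card_image) (rule inj_on_subset[OF inj_on_diff_cone_below], blast)
  moreover have "card ?L + card ?U = card (?L \<union> ?U) + card (?L \<inter> ?U)"
    using assms by (intro card_Un_Int) auto
  moreover have "card (?L \<union> ?U) \<le> card ?B"
    using assms cone_below_diff by (intro card_mono) auto
  ultimately show ?thesis
    using inter by linarith
qed

text \<open>The bound says that \<open>h\<close> is at most half the size of
  \<open>cone_below C f\<close>, rounded up. An upper bound is enough, as larger genera are reached
  from \<open>h\<close> step by step.\<close>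

lemma exists_small_genus:
  assumes "finite (lower_set le C f)" "f \<in> C - {0}"
  obtains S h where "S \<in> semigroups_Fb_genus le C f h" "2 * h \<le> card (cone_below C f) + 1"
proof -
  let ?B = "cone_below C f"
  let ?L = "{x \<in> ?B. le (x + x) f}"
  \<comment> \<open>Both ends of \<open>?B\<close> are exceptions to the doubling criterion:
    \<open>0\<close> must belong to the semigroup and \<open>f\<close> must be a gap.\<close>
  let ?S = "{x \<in> C. x = 0 \<or> x \<noteq> f \<and> (x \<notin> ?B \<or> \<not> le (x + x) f)}"
  have fin: "finite ?B"
    using finite_cone_below assms(1) .
  have fB: "f \<in> ?B"
    using assms(2) cone_zero by (simp add: cone_below_iff)
  have gaps: "C - ?S = insert f (?L - {0})"
    using fB assms(2) by (auto simp: cone_below_def)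
  have "x + y \<in> ?S" if x: "x \<in> ?S" and y: "y \<in> ?S" for x y
  proof (cases "x = 0 \<or> y = 0")
    case True
    then show ?thesis
      using x y by auto
  next
    case False
    have xy: "x \<in> C" "y \<in> C"
      using x y by auto
    \<comment> \<open>This also excludes \<open>x + y = f\<close>, because \<open>f\<close> lies in
      \<open>?B\<close>.\<close>
    have "x + y \<notin> ?B"
    proof
      assume sum: "x + y \<in> ?B"
      then have "x \<in> ?B" "y \<in> ?B"
        using xy cone_below_addD[of x y] cone_below_addD[of y x] by (auto simp: add.commute)
      then have "\<not> le (x + x) f" "\<not> le (y + y) f"
        using x y False by auto
      then have lt: "le f (x + x)" "le f (y + y)" "f \<noteq> x + x"
        using le_total le_refl by blast+
      \<comment> \<open>The chain \<open>2(x + y) \<le> 2f \<le> 2x + f \<le> 2x + 2y\<close> closes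
        up, so all its terms agree and \<open>f = x + x\<close>, which is excluded.\<close>
      have "le ((x + y) + (x + y)) (f + f)"
        using cone_below_le[OF sum] le_add_mono by blast
      moreover have "le (f + f) ((x + x) + f)" "le ((x + x) + f) ((x + x) + (y + y))"
        using lt le_add_mono le_refl by blast+
      moreover have "(x + x) + (y + y) = (x + y) + (x + y)"
        by (simp add: ac_simps)
      ultimately have "f + f = (x + x) + f"
        using le_antisym le_trans by metis
      then show False
        using lt(3) by simp
    qed
    then show ?thesis
      using xy cone_add fB by auto
  qed
  moreover have "finite (C - ?S)"
    unfolding gaps using fin by simp
  ultimately have "C_semigroup C ?S"
    unfolding C_semigroup_def using cone_zero by blast
  moreover have "f \<in> C - ?S" "\<forall>x\<in>C - ?S. le x f"
    unfolding gaps using cone_below_le le_refl by auto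
  ultimately have "?S \<in> semigroups_Fb_genus le C f (card (C - ?S))"
    unfolding semigroups_Fb_genus_iff by blast
  \<comment> \<open>Passing from \<open>?L\<close> to the gaps trades \<open>0\<close> for
    \<open>f\<close>.\<close>
  moreover have "card (C - ?S) \<le> card ?L"
  proof -
    have "0 \<in> ?L"
      using assms(2) cone_zero zero_le by (simp add: cone_below_iff)
    moreover have "finite ?L"
      using fin by simp
    ultimately have "0 < card ?L" "card (?L - {0}) = card ?L - 1"
      using card_Diff_singleton[of 0 ?L] card_gt_0_iff[of ?L] by blast+
    then show ?thesis
      unfolding gaps by (intro card_insert_le_m1) simp_all
  qed
  ultimately show ?thesis
    using that[of ?S "card (C - ?S)"] double_card_lower_half[OF fin] by linarith
qed

section \<open>Raising the genus one gap at a time\<close>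

lemma exists_Suc_genus:
  assumes "finite (lower_set le C f)"
    and S: "S \<in> semigroups_Fb_genus le C f h" and "h < card (lower_set le C f)"
  shows "semigroups_Fb_genus le C f (Suc h) \<noteq> {}"
proof -
  let ?M = "lower_set le C f \<inter> S"
  have SC: "S \<subseteq> C" "0 \<in> S" "\<And>x y. x \<in> S \<Longrightarrow> y \<in> S \<Longrightarrow> x + y \<in> S" "finite (C - S)"
    and f: "f \<in> C - S" "\<forall>x\<in>C - S. le x f" and card: "card (C - S) = h"
    using S by (auto simp: semigroups_Fb_genus_iff C_semigroup_def)
  \<comment> \<open>Otherwise the \<open>h\<close> gaps would contain the whole of
    \<open>lower_set le C f\<close>, which has more than \<open>h\<close> elements.\<close>
  have "?M \<noteq> {}"
  proof
    assume "?M = {}"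
    then have "lower_set le C f \<subseteq> C - S"
      by (auto simp: lower_set_def)
    then show False
      using card_mono[OF SC(4), of "lower_set le C f"] card assms(3) by simp
  qed
  with assms(1) obtain m where m: "m \<in> ?M" and min: "\<And>x. x \<in> ?M \<Longrightarrow> le m x"
    using finite_has_least[of ?M] by blast
  have mf: "m \<in> C" "m \<in> S" "m \<noteq> 0" "le m f"
    using m by (auto simp: lower_set_def)
  have gaps: "C - (S - {m}) = insert m (C - S)"
    using mf by blast
  \<comment> \<open>Minimality makes \<open>m\<close> irreducible in \<open>S\<close>: a non-zero
    summand \<open>x\<close> of \<open>m\<close> satisfies \<open>x \<le> m \<le> f\<close>, so it
    lies in \<open>?M\<close> and equals \<open>m\<close>, while \<open>x = 0\<close> would give
    \<open>y = m\<close>.\<close>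
  have "x + y \<noteq> m" if "x \<in> S - {m}" "y \<in> S - {m}" for x y
  proof
    assume eq: "x + y = m"
    with that have "x \<noteq> 0"
      by auto
    moreover have "le x m"
      using eq le_add_self by blast
    ultimately have "x \<in> ?M"
      using that SC(1) mf(4) le_trans by (auto simp: lower_set_def)
    then have "x = m"
      using min \<open>le x m\<close> le_antisym by blast
    then show False
      using that by blast
  qed
  then have "C_semigroup C (S - {m})"
    using SC mf(3) gaps by (auto simp: C_semigroup_def)
  moreover have "card (C - (S - {m})) = Suc h"
    using gaps mf(2) SC(4) card by simp
  ultimately have "S - {m} \<in> semigroups_Fb_genus le C f (Suc h)"
    using f mf(4) gaps by (auto simp: semigroups_Fb_genus_iff)
  then show ?thesis
    by blast
qed

lemma exists_larger_genus:
  assumes "finite (lower_set le C f)" "semigroups_Fb_genus le C f h \<noteq> {}"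
    and "h \<le> g" "g \<le> card (lower_set le C f)"
  shows "semigroups_Fb_genus le C f g \<noteq> {}"
  using assms(3,4)
proof (induction g rule: dec_induct)
  case base
  then show ?case
    using assms(2) by simp
next
  case (step n)
  then show ?case
    using exists_Suc_genus[OF assms(1), of _ n] by auto
qed

section \<open>The equivalence, first without the ceiling\<close>

lemma semigroups_Fb_genus_nonempty_iff:
  assumes "finite (lower_set le C f)" "f \<in> C - {0}"
  shows "semigroups_Fb_genus le C f g \<noteq> {} \<longleftrightarrow>
    card (cone_below C f) \<le> 2 * g \<and> g \<le> card (lower_set le C f)"
proof
  assume "semigroups_Fb_genus le C f g \<noteq> {}"
  then obtain S where S: "S \<in> semigroups_Fb_genus le C f g"
    by blast
  then have "g \<le> card (lower_set le C f)"
    using card_mono[OF assms(1) gaps_subset_lower_set[OF S]] by (simp add: semigroups_Fb_genus_iff)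
  with S show "card (cone_below C f) \<le> 2 * g \<and> g \<le> card (lower_set le C f)"
    using card_cone_below_le_double_genus by blast
next
  assume g: "card (cone_below C f) \<le> 2 * g \<and> g \<le> card (lower_set le C f)"
  obtain S h where S: "S \<in> semigroups_Fb_genus le C f h"
    and h: "2 * h \<le> card (cone_below C f) + 1"
    using exists_small_genus[OF assms] .
  \<comment> \<open>Integrality absorbs the \<open>+ 1\<close>: \<open>2 * h \<le> 2 * g + 1\<close>
    forces \<open>h \<le> g\<close>.\<close>
  have "h \<le> g"
    using g h by linarith
  then show "semigroups_Fb_genus le C f g \<noteq> {}"
    using exists_larger_genus[OF assms(1)] S g by blast
qed

end

theorem theorem4:
  fixes C :: "(nat ^ 'p) set"
    and le :: "nat ^ 'p \<Rightarrow> nat ^ 'p \<Rightarrow> bool"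
    and f :: "nat ^ 'p"
    and g :: nat
  assumes "affine_integer_cone C"
    and "monoid_total_order le"
    and "\<And>x. x \<in> C \<Longrightarrow> finite (lower_set le C x)"
    and "f \<in> C - {0}"
    and "0 < g"
  shows "semigroups_Fb_genus le C f g \<noteq> {} \<longleftrightarrow>
    \<lceil>real (card (cone_below C f)) / 2\<rceil> \<le> int g \<and> g \<le> card (lower_set le C f)"
proof -
  interpret ordered_cone C le
    using ordered_coneI assms(1,2) .
  have "\<lceil>real (card (cone_below C f)) / 2\<rceil> \<le> int g \<longleftrightarrow> card (cone_below C f) \<le> 2 * g"
    unfolding ceiling_le_iff by (simp add: field_simps flip: of_nat_mult) linarith
  then show ?thesis
    using semigroups_Fb_genus_nonempty_iff[of f g] assms(3,4) by simp
qed

end
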